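(* Consider the problem of finding $$g_{\rm f}(\tilde\phi_1)=\arg\min_g\int\mathcal F(g(\tilde\phi_1))\,d\tilde\phi_1\quad\text{subject to}\quad\int g(\tilde\phi_1)\,d\tilde\phi_1=M,$$ where $g$ is the density of the number of quantized subsections, $M$ is the number of quantization steps, and $$\mathcal F(g(\tilde\phi_1))=\frac1{12}\tilde\theta_1^2\,g(\tilde\phi_1)^{-2}\,\sigma^2(\tilde\phi_1)\,f(\tilde\phi_1).$$ The solution is $$g_{\rm f}(\tilde\phi_1)=K\,\sigma^{2/3}(\tilde\phi_1)\,f^{1/3}(\tilde\phi_1),\qquad K=D^{-1}M,\qquad D=\int\sigma^{2/3}(\tilde\phi_1)\,f^{1/3}(\tilde\phi_1)\,d\tilde\phi_1.$$ Moreover, the optimized value is $$\int\mathcal F(g_{\rm f}(\tilde\phi_1))\,d\tilde\phi_1=\frac1{12}\tilde\theta_1^2\,D^3M^{-2}.$$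
   Context: Setting: $\phi(t)=[u(t)\ u(t-1)\ \cdots\ u(t-n+1)]$ is the regressor vector of a finite impulse response system with output $y(t)=\phi(t)\theta$, $\theta\in\mathbb R^n$. $T$ is an orthogonal matrix with $T^{-1}\theta=[\tilde\theta_1,0,\dots,0]^{\rm T}$, and $\tilde\phi=\phi T=[\tilde\phi_1\ \cdots\ \tilde\phi_n]$, so $y=\tilde\theta_1\tilde\phi_1$. $f(\tilde\phi_1,\dots,\tilde\phi_n)$ is the joint density of $\tilde\phi$, $f(\tilde\phi_1)=\int f(\tilde\phi_1,\dots,\tilde\phi_n)\,d\tilde\phi_2\cdots d\tilde\phi_n$ is the marginal density, and $$\sigma(\tilde\phi_1)=\Big(f(\tilde\phi_1)^{-1}\int\Big(\sum_{k=1}^n\tilde\phi_k^2\Big)f(\tilde\phi_1,\dots,\tilde\phi_n)\,d\tilde\phi_2\cdots d\tilde\phi_n\Big)^{1/2}.$$ The output is quantized by a symmetric memoryless quantizer; equivalently, the $\tilde\phi_1$-axis is divided into quantized subsections. The density of the number of quantized subsections is the function $g$ such that $g(\tilde\phi_1)\,d\tilde\phi_1$ is the number of quantized subsections in $d\tilde\phi_1$ (so $g(\tilde\phi_1)^{-1}$ is the width of the quantization step at $\tilde\phi_1$). Standing assumptions: the inputs $u(t)$ are mutually independent; $f(\phi)$ is continuous and, in the neighborhood of an arbitrary point $\tilde\phi^\circ$, $f(\tilde\phi)=\delta_0+\sum_i\delta_i(\tilde\phi_i-\tilde\phi_i^\circ)+\sum_{i,j}\delta_{ij}(\tilde\phi_i-\tilde\phi_i^\circ)(\tilde\phi_j-\tilde\phi_j^\circ)+O((\tilde\phi_i-\tilde\phi_i^\circ)(\tilde\phi_j-\tilde\phi_j^\circ)(\tilde\phi_k-\tilde\phi_k^\circ))$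 with $|\delta_\bullet|<\infty$; $\frac{d(\sigma^2(\tilde\phi_1)f(\tilde\phi_1))}{d\tilde\phi_1}<\infty$; the resolution of the quantizer is sufficiently high and $\frac{d\,g(\tilde\phi_1)^{-2}}{d\tilde\phi_1}<\infty$. *)

theory Defs
  imports "HOL-Probability.Probability" "HOL-Library.Landau_Symbols"
begin

text \<open>
  Vectors in \<open>\<real>\<^sup>n\<close> have type \<^typ>\<open>real ^ 'n\<close>.  The order of the coordinates is given by an
  enumeration \<open>e\<close> of the index type with values \<open>0, \<dots>, n - 1\<close>; the coordinate called
  "first" is the index \<open>o1\<close> with \<open>e o1 = 0\<close>.
\<close>

definition regressor :: "('n::finite \<Rightarrow> nat) \<Rightarrow> (int \<Rightarrow> 'w \<Rightarrow> real) \<Rightarrow> int \<Rightarrow> 'w \<Rightarrow> real ^ 'n" where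
  "regressor e u t \<omega> = (\<chi> i. u (t - int (e i)) \<omega>)"

definition transformed_regressor ::
    "('n::finite \<Rightarrow> nat) \<Rightarrow> real ^ 'n ^ 'n \<Rightarrow> (int \<Rightarrow> 'w \<Rightarrow> real) \<Rightarrow> int \<Rightarrow> 'w \<Rightarrow> real ^ 'n" where
  "transformed_regressor e T u t \<omega> = regressor e u t \<omega> v* T"

definition second_order_expandable :: "(real ^ 'n::finite \<Rightarrow> real) \<Rightarrow> bool" where
  "second_order_expandable f \<longleftrightarrow>
    (\<forall>p. \<exists>(d0::real) (d1 :: 'n \<Rightarrow> real) (d2 :: 'n \<Rightarrow> 'n \<Rightarrow> real).
      (\<lambda>x. f x - (d0 + (\<Sum>i\<in>UNIV. d1 i * (x $ i - p $ i))
                     + (\<Sum>i\<in>UNIV. \<Sum>j\<in>UNIV. d2 i j * (x $ i - p $ i) * (x $ j - p $ j))))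
      \<in> O[nhds p](\<lambda>x. \<Sum>i\<in>UNIV. \<Sum>j\<in>UNIV. \<Sum>k\<in>UNIV.
            \<bar>(x $ i - p $ i) * (x $ j - p $ j) * (x $ k - p $ k)\<bar>))"

text \<open>
  Integration over all coordinates other than \<open>o1\<close> uses the product of Lebesgue measures indexed
  by the remaining coordinates (for \<open>n = 1\<close> this is the unit mass at the empty tuple, so that
  no integration takes place).
\<close>

definition other_coords :: "'n::finite \<Rightarrow> ('n \<Rightarrow> real) measure" where
  "other_coords o1 = Pi\<^sub>M (UNIV - {o1}) (\<lambda>_. lborel)"

definition insert_coord :: "'n::finite \<Rightarrow> real \<Rightarrow> ('n \<Rightarrow> real) \<Rightarrow> real ^ 'n" where
  "insert_coord o1 s x = (\<chi> i. if i = o1 then s else x i)"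

definition marginal :: "'n::finite \<Rightarrow> (real ^ 'n \<Rightarrow> real) \<Rightarrow> real \<Rightarrow> real" where
  "marginal o1 f s = (\<integral>x. f (insert_coord o1 s x) \<partial>other_coords o1)"

definition moment_integrand :: "'n::finite \<Rightarrow> (real ^ 'n \<Rightarrow> real) \<Rightarrow> real \<Rightarrow> ('n \<Rightarrow> real) \<Rightarrow> real" where
  "moment_integrand o1 f s x =
    (\<Sum>k\<in>UNIV. (insert_coord o1 s x $ k)\<^sup>2) * f (insert_coord o1 s x)"

definition sigma_rms :: "'n::finite \<Rightarrow> (real ^ 'n \<Rightarrow> real) \<Rightarrow> real \<Rightarrow> real" where
  "sigma_rms o1 f s = sqrt (inverse (marginal o1 f s) * (\<integral>x. moment_integrand o1 f s x \<partial>other_coords o1))"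

text \<open>
  The error density and the cost take values in \<^typ>\<open>ennreal\<close>, so that \<open>v\<^sup>-\<^sup>2 = \<infinity>\<close> for \<open>v = 0\<close>:
  a density \<open>g\<close> vanishing on a non-null set where \<open>\<sigma>\<^sup>2 f > 0\<close> has infinite cost (for a nonzero
  parameter), whereas \<open>\<infinity> * 0 = 0\<close> where \<open>\<sigma>\<^sup>2 f = 0\<close>.  Over the reals, \<open>inverse 0 = 0\<close> would
  instead make such \<open>g\<close> artificially cheap.
\<close>

definition error_density :: "real \<Rightarrow> 'n::finite \<Rightarrow> (real ^ 'n \<Rightarrow> real) \<Rightarrow> real \<Rightarrow> real \<Rightarrow> ennreal" where
  "error_density \<theta>1 o1 f s v =
    ennreal (1 / 12 * \<theta>1\<^sup>2) * inverse ((ennreal v)\<^sup>2) * ennreal ((sigma_rms o1 f s)\<^sup>2 * marginal o1 f s)"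

definition cost :: "real \<Rightarrow> 'n::finite \<Rightarrow> (real ^ 'n \<Rightarrow> real) \<Rightarrow> (real \<Rightarrow> real) \<Rightarrow> ennreal" where
  "cost \<theta>1 o1 f g = (\<integral>\<^sup>+s. error_density \<theta>1 o1 f s (g s) \<partial>lborel)"

definition step_density :: "nat \<Rightarrow> (real \<Rightarrow> real) \<Rightarrow> bool" where
  "step_density M g \<longleftrightarrow> (\<forall>s. 0 \<le> g s) \<and> has_bochner_integral lborel g (real M)"

text \<open>
  Finiteness of the derivative of \<open>g\<^sup>-\<^sup>2\<close> is required where \<open>g\<^sup>-\<^sup>2\<close> is itself finite.
\<close>

definition regular_density :: "(real \<Rightarrow> real) \<Rightarrow> bool" where
  "regular_density g \<longleftrightarrow> (\<forall>s. g s \<noteq> 0 \<longrightarrow> (\<lambda>r. inverse ((g r)\<^sup>2)) differentiable (at s))"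

definition profile :: "'n::finite \<Rightarrow> (real ^ 'n \<Rightarrow> real) \<Rightarrow> real \<Rightarrow> real" where
  "profile o1 f s = sigma_rms o1 f s powr (2 / 3) * marginal o1 f s powr (1 / 3)"

definition profile_mass :: "'n::finite \<Rightarrow> (real ^ 'n \<Rightarrow> real) \<Rightarrow> real" where
  "profile_mass o1 f = (\<integral>s. profile o1 f s \<partial>lborel)"

definition optimal_density :: "nat \<Rightarrow> 'n::finite \<Rightarrow> (real ^ 'n \<Rightarrow> real) \<Rightarrow> real \<Rightarrow> real" where
  "optimal_density M o1 f s = inverse (profile_mass o1 f) * real M * profile o1 f s"

end

theory Submission
  imports Defs
begin

text \<open>
  Write \<open>p\<close> for the profile \<open>\<sigma>\<^sup>2\<^sup>/\<^sup>3 f\<^sup>1\<^sup>/\<^sup>3\<close>, \<open>D\<close> for its integral and \<open>c = \<theta>1\<^sup>2 / 12\<close>.  Because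
  \<open>\<sigma>\<^sup>2 f = p\<^sup>3\<close>, the cost of a density \<open>g\<close> is \<open>c \<integral> p\<^sup>3 / g\<^sup>2\<close>.  The function \<open>v \<mapsto> p\<^sup>3 / v\<^sup>2\<close> is convex, so
  it lies above its tangent at \<open>v = k p\<close>:
  \<open>p\<^sup>3 / v\<^sup>2 \<ge> 3 p / k\<^sup>2 - 2 v / k\<^sup>3\<close>, with equality only at the point of tangency.
  The slope \<open>- 2 / k\<^sup>3\<close> is the same for every argument \<open>s\<close>; it is the Lagrange multiplier of the constraint.
  Integrating over \<open>s\<close>, any \<open>g\<close> of total mass \<open>M\<close> has cost at least
  \<open>c (3 D / k\<^sup>2 - 2 M / k\<^sup>3)\<close>.  With \<open>k = M / D\<close> this is \<open>c D\<^sup>3 / M\<^sup>2\<close>, which is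
  the cost of \<open>k p\<close>, and the equality case of the tangent inequality gives uniqueness almost
  everywhere (lemmas \<open>tangent_bound\<close>, \<open>allocation_lower_bound\<close> and
  \<open>allocation_unique\<close>).

  The choice \<open>k = M / D\<close> requires \<open>D > 0\<close>.  This is where the probabilistic data enter: \<open>f\<close> is a
  continuous probability density, hence positive on some cube, and there the marginal density and the
  second moment are positive on an interval of arguments, except possibly at \<open>0\<close> (lemma
  \<open>profile_mass_pos\<close>).
  Finally, \<open>(k p)\<^sup>-\<^sup>2\<close> is a negative power of \<open>\<sigma>\<^sup>2 f\<close>, which makes the optimal density an admissible
  competitor also in the class of regular densities.
\<close>

section \<open>Allocating a fixed mass against an inverse-square cost\<close>

definition allocation_cost :: "'a measure \<Rightarrow> real \<Rightarrow> ('a \<Rightarrow> real) \<Rightarrow> ('a \<Rightarrow> real) \<Rightarrow> ennreal" where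
  "allocation_cost N c p g =
    (\<integral>\<^sup>+x. ennreal c * inverse ((ennreal (g x))\<^sup>2) * ennreal (p x ^ 3) \<partial>N)"

lemma inverse_square_cost_pos:
  assumes "0 < v" "0 \<le> c" "0 \<le> p"
  shows "ennreal c * inverse ((ennreal v)\<^sup>2) * ennreal (p ^ 3) = ennreal (c * p ^ 3 / v\<^sup>2)"
  using assms
  by (simp add: ennreal_power inverse_ennreal flip: ennreal_mult) (simp add: field_simps)

text \<open>
  The distance from the convex function down to its tangent has a double zero at the point of tangency.
  Splitting it off leaves a positive factor, so the same formula gives the inequality and its equality
  case.
\<close>
lemma tangent_gap:
  fixes p v k :: real
  assumes "0 < v" "0 < k"
  shows "p ^ 3 / v\<^sup>2 + 2 * v / k ^ 3 - 3 * p / k\<^sup>2 = (v - k * p)\<^sup>2 * (2 * v + k * p) / (v\<^sup>2 * k ^ 3)"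
  using assms by (simp add: field_simps power2_eq_square power3_eq_cube)

text \<open>
  The tangent inequality with the linear term on the side of the cost, so that it survives in
  \<^typ>\<open>ennreal\<close>, where the cost is infinite if \<open>v = 0 < p\<close>.
\<close>
lemma tangent_bound:
  assumes "0 \<le> v" "0 \<le> p" "0 \<le> c" "0 < k"
  shows "ennreal (c * (3 * p / k\<^sup>2))
    \<le> ennreal c * inverse ((ennreal v)\<^sup>2) * ennreal (p ^ 3) + ennreal (c * (2 * v / k ^ 3))"
proof (cases "v = 0")
  case True
  show ?thesis
  proof (cases "c = 0 \<or> p = 0")
    case True
    then show ?thesis by auto
  next
    case False
    with assms \<open>v = 0\<close> show ?thesis
      by (simp add: ennreal_mult_top ennreal_top_mult)
  qed
next
  case False
  with assms have v: "0 < v" by simp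
  have "0 \<le> (v - k * p)\<^sup>2 * (2 * v + k * p) / (v\<^sup>2 * k ^ 3)"
    using assms by simp
  then have "3 * p / k\<^sup>2 \<le> p ^ 3 / v\<^sup>2 + 2 * v / k ^ 3"
    using tangent_gap[OF v \<open>0 < k\<close>, of p] by linarith
  then have "c * (3 * p / k\<^sup>2) \<le> c * p ^ 3 / v\<^sup>2 + c * (2 * v / k ^ 3)"
    using mult_left_mono[OF _ \<open>0 \<le> c\<close>] by (fastforce simp: distrib_left)
  then show ?thesis
    using assms v by (simp add: inverse_square_cost_pos ennreal_leI flip: ennreal_plus)
qed

lemma tangent_bound_eq:
  assumes "0 \<le> v" "0 \<le> p" "0 < c" "0 < k"
    and le: "ennreal c * inverse ((ennreal v)\<^sup>2) * ennreal (p ^ 3) + ennreal (c * (2 * v / k ^ 3))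
      \<le> ennreal (c * (3 * p / k\<^sup>2))"
  shows "v = k * p"
proof (cases "v = 0")
  case True
  have "p = 0"
  proof (rule ccontr)
    assume "p \<noteq> 0"
    with assms True show False
      by (simp add: ennreal_mult_top ennreal_top_mult top_unique)
  qed
  with True show ?thesis by simp
next
  case False
  with assms have v: "0 < v" by simp
  have "ennreal (c * p ^ 3 / v\<^sup>2 + c * (2 * v / k ^ 3)) \<le> ennreal (c * (3 * p / k\<^sup>2))"
    using le assms v by (simp add: inverse_square_cost_pos flip: ennreal_plus)
  then have "c * p ^ 3 / v\<^sup>2 + c * (2 * v / k ^ 3) \<le> c * (3 * p / k\<^sup>2)"
    using assms by (subst (asm) ennreal_le_iff) auto
  then have "c * (p ^ 3 / v\<^sup>2 + 2 * v / k ^ 3) \<le> c * (3 * p / k\<^sup>2)"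
    by (simp add: distrib_left)
  then have "p ^ 3 / v\<^sup>2 + 2 * v / k ^ 3 - 3 * p / k\<^sup>2 \<le> 0"
    unfolding mult_le_cancel_left_pos[OF \<open>0 < c\<close>] by simp
  then have "(v - k * p)\<^sup>2 * (2 * v + k * p) / (v\<^sup>2 * k ^ 3) \<le> 0"
    by (simp only: tangent_gap[OF v \<open>0 < k\<close>])
  moreover have "0 < v\<^sup>2 * k ^ 3" and pos: "0 < 2 * v + k * p"
    using assms v by (simp_all add: add_pos_nonneg)
  ultimately have "(v - k * p)\<^sup>2 * (2 * v + k * p) \<le> 0"
    by (simp only: divide_le_0_iff) linarith
  then have "(v - k * p)\<^sup>2 \<le> 0"
    using pos by (simp only: mult_le_0_iff) linarith
  then show ?thesis by simp
qed

lemma nn_integral_scaled: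
  assumes "has_bochner_integral N h I" "\<And>x. 0 \<le> h x" "0 \<le> (a::real)"
  shows "(\<integral>\<^sup>+x. ennreal (a * h x) \<partial>N) = ennreal (a * I)"
  using assms
  by (subst nn_integral_eq_integral)
     (auto simp: has_bochner_integral_iff)

lemma nn_integral_cost_plus_linear:
  assumes p: "has_bochner_integral N p D" and g: "has_bochner_integral N g m"
    and "\<And>x. 0 \<le> g x" "0 \<le> c" "0 < k"
  shows "(\<integral>\<^sup>+x. ennreal c * inverse ((ennreal (g x))\<^sup>2) * ennreal (p x ^ 3)
      + ennreal (c * (2 * g x / k ^ 3)) \<partial>N) = allocation_cost N c p g + ennreal (c * (2 * m / k ^ 3))"
proof -
  have [measurable]: "p \<in> borel_measurable N" "g \<in> borel_measurable N"
    using p g by (auto simp: has_bochner_integral_iff)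
  have "(\<integral>\<^sup>+x. ennreal (c * (2 * g x / k ^ 3)) \<partial>N) = ennreal (c * (2 * m / k ^ 3))"
    using nn_integral_scaled[OF g, of "c * 2 / k ^ 3"] assms by (simp add: mult.assoc)
  then show ?thesis
    unfolding allocation_cost_def by (subst nn_integral_add) auto
qed

lemma allocation_lower_bound:
  assumes p: "has_bochner_integral N p D" "\<And>x. 0 \<le> p x" and g: "has_bochner_integral N g m" "\<And>x. 0 \<le> g x"
    and "0 \<le> c" "0 < D" "0 < m"
  shows "ennreal (c * D ^ 3 / m\<^sup>2) \<le> allocation_cost N c p g"
proof -
  define k where "k = m / D"
  have k: "0 < k" using assms by (simp add: k_def)
  have "ennreal (c * (3 * D / k\<^sup>2)) = (\<integral>\<^sup>+x. ennreal (c * (3 * p x / k\<^sup>2)) \<partial>N)"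
    using nn_integral_scaled[OF p, of "c * 3 / k\<^sup>2"] assms by (simp add: mult.assoc)
  also have "\<dots> \<le> allocation_cost N c p g + ennreal (c * (2 * m / k ^ 3))"
    by (subst nn_integral_cost_plus_linear[OF p(1) g \<open>0 \<le> c\<close> k, symmetric])
       (intro nn_integral_mono tangent_bound assms k)
  also have "c * (3 * D / k\<^sup>2) = c * D ^ 3 / m\<^sup>2 + c * (2 * m / k ^ 3)"
    using assms by (simp add: k_def field_simps power2_eq_square power3_eq_cube)
  finally show ?thesis
    using assms k by (simp add: ennreal_plus)
qed

text \<open>
  An allocation attaining the lower bound attains the tangent inequality at almost every point, since
  the integrals of its two sides agree and are finite.
\<close>
lemma allocation_unique:
  assumes p: "has_bochner_integral N p D" "\<And>x. 0 \<le> p x" and g: "has_bochner_integral N g m" "\<And>x. 0 \<le> g x"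
    and "0 < c" "0 < D" "0 < m"
    and le: "allocation_cost N c p g \<le> ennreal (c * D ^ 3 / m\<^sup>2)"
  shows "AE x in N. g x = m / D * p x"
proof -
  define k where "k = m / D"
  have k: "0 < k" using assms by (simp add: k_def)
  define A where "A x = ennreal c * inverse ((ennreal (g x))\<^sup>2) * ennreal (p x ^ 3)
      + ennreal (c * (2 * g x / k ^ 3))" for x
  define L where "L x = ennreal (c * (3 * p x / k\<^sup>2))" for x
  have [measurable]: "p \<in> borel_measurable N" "g \<in> borel_measurable N"
    using p g by (auto simp: has_bochner_integral_iff)
  have L: "(\<integral>\<^sup>+x. L x \<partial>N) = ennreal (c * (3 * D / k\<^sup>2))"
    unfolding L_def using nn_integral_scaled[OF p, of "c * 3 / k\<^sup>2"] assms by (simp add: mult.assoc)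
  have "(\<integral>\<^sup>+x. A x \<partial>N) = allocation_cost N c p g + ennreal (c * (2 * m / k ^ 3))"
    unfolding A_def using nn_integral_cost_plus_linear[OF p(1) g _ k] assms by simp
  also have "\<dots> \<le> ennreal (c * D ^ 3 / m\<^sup>2) + ennreal (c * (2 * m / k ^ 3))"
    using le by (intro add_right_mono)
  also have "\<dots> = ennreal (c * D ^ 3 / m\<^sup>2 + c * (2 * m / k ^ 3))"
    using assms k by (simp add: ennreal_plus)
  also have "c * D ^ 3 / m\<^sup>2 + c * (2 * m / k ^ 3) = c * (3 * D / k\<^sup>2)"
    using assms by (simp add: k_def field_simps power2_eq_square power3_eq_cube)
  finally have le: "(\<integral>\<^sup>+x. A x \<partial>N) \<le> (\<integral>\<^sup>+x. L x \<partial>N)"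
    by (simp add: L)
  have "AE x in N. A x \<le> L x"
  proof (rule ccontr)
    assume "\<not> (AE x in N. A x \<le> L x)"
    moreover have "L x \<le> A x" for x
      unfolding L_def A_def using assms k by (intro tangent_bound) auto
    ultimately have "(\<integral>\<^sup>+x. L x \<partial>N) < (\<integral>\<^sup>+x. A x \<partial>N)"
      by (intro nn_integral_less) (auto simp: L, auto simp: A_def L_def)
    with le show False by simp
  qed
  then have "AE x in N. g x = k * p x"
    unfolding A_def L_def by eventually_elim (rule tangent_bound_eq, use assms k in auto)
  then show ?thesis by (simp add: k_def)
qed

lemma allocation_cost_optimal:
  assumes p: "has_bochner_integral N p D" "\<And>x. 0 \<le> p x" and "0 \<le> c" "0 < D" "0 < m"
  shows "allocation_cost N c p (\<lambda>x. m / D * p x) = ennreal (c * D ^ 3 / m\<^sup>2)"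
proof -
  have "ennreal c * inverse ((ennreal (m / D * p x))\<^sup>2) * ennreal (p x ^ 3)
      = ennreal (c * D\<^sup>2 / m\<^sup>2 * p x)" for x
  proof (cases "p x = 0")
    case False
    with p(2)[of x] have "0 < p x" by simp
    then show ?thesis
      using assms by (subst inverse_square_cost_pos) (auto simp: field_simps power2_eq_square power3_eq_cube)
  qed simp
  then show ?thesis
    unfolding allocation_cost_def
    using nn_integral_scaled[OF p, of "c * D\<^sup>2 / m\<^sup>2"] assms
    by (simp add: power2_eq_square power3_eq_cube mult.assoc)
qed

section \<open>The profile of a density\<close>

lemma marginal_nonneg:
  assumes "\<And>x. 0 \<le> f x"
  shows "0 \<le> marginal o1 f s"
  unfolding marginal_def using assms by (intro Bochner_Integration.integral_nonneg) auto

lemma sigma_rms_nonneg: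
  assumes "\<And>x. 0 \<le> f x"
  shows "0 \<le> sigma_rms o1 f s"
  unfolding sigma_rms_def using marginal_nonneg[of f, OF assms]
  by (auto simp: moment_integrand_def assms intro!: mult_nonneg_nonneg Bochner_Integration.integral_nonneg sum_nonneg)

lemma profile_nonneg: "0 \<le> profile o1 f s"
  by (simp add: profile_def)

lemma profile_eq_powr:
  assumes "\<And>x. 0 \<le> f x"
  shows "profile o1 f s = ((sigma_rms o1 f s)\<^sup>2 * marginal o1 f s) powr (1 / 3)"
proof -
  have "sigma_rms o1 f s powr (2 / 3) = ((sigma_rms o1 f s)\<^sup>2) powr (1 / 3)"
    using sigma_rms_nonneg[of f o1 s, OF assms]
    by (cases "sigma_rms o1 f s = 0") (auto simp: powr_powr simp flip: powr_numeral)
  then show ?thesis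
    unfolding profile_def using marginal_nonneg[of f, OF assms] by (simp add: powr_mult)
qed

lemma profile_cubed:
  assumes "\<And>x. 0 \<le> f x"
  shows "profile o1 f s ^ 3 = (sigma_rms o1 f s)\<^sup>2 * marginal o1 f s"
proof -
  have "(w powr (1 / 3)) ^ 3 = w" if "0 \<le> w" for w :: real
    using that by (cases "w = 0") (auto simp: powr_powr simp flip: powr_numeral)
  then show ?thesis
    using marginal_nonneg[of f o1 s, OF assms] by (simp add: profile_eq_powr[of f, OF assms])
qed

lemma cost_eq_allocation_cost:
  assumes "\<And>x. 0 \<le> f x"
  shows "cost \<theta>1 o1 f g = allocation_cost lborel (1 / 12 * \<theta>1\<^sup>2) (profile o1 f) g"
  unfolding cost_def error_density_def allocation_cost_def profile_cubed[of f, OF assms] ..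

text \<open>
  The optimal density is a multiple of the cube root of \<open>\<sigma>\<^sup>2 f\<close>, so its inverse square is a multiple of
  the power \<open>- 2 / 3\<close> of \<open>\<sigma>\<^sup>2 f\<close>, which inherits differentiability wherever \<open>\<sigma>\<^sup>2 f\<close> is positive.
\<close>
lemma regular_optimal_density:
  assumes nonneg: "\<And>x. 0 \<le> f x"
    and diff: "\<And>s. (\<lambda>r. (sigma_rms o1 f r)\<^sup>2 * marginal o1 f r) differentiable (at s)"
  shows "regular_density (optimal_density M o1 f)"
  unfolding regular_density_def
proof (intro allI impI)
  fix s
  define w where "w r = (sigma_rms o1 f r)\<^sup>2 * marginal o1 f r" for r
  define a where "a = inverse (profile_mass o1 f) * real M"
  have w_nonneg: "0 \<le> w r" for r
    using marginal_nonneg[of f, OF nonneg] by (simp add: w_def)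
  have g: "optimal_density M o1 f r = a * w r powr (1 / 3)" for r
    by (simp add: optimal_density_def profile_eq_powr[of f, OF nonneg] a_def w_def)
  assume "optimal_density M o1 f s \<noteq> 0"
  then have ws: "0 < w s"
    using w_nonneg[of s] by (auto simp: g less_le)
  (* At zeros of w both sides vanish, by the conventions for inverse and powr at 0. *)
  have eq: "inverse ((optimal_density M o1 f r)\<^sup>2) = inverse (a\<^sup>2) * w r powr (- 2 / 3)" for r
    using w_nonneg[of r]
    by (cases "w r = 0")
       (auto simp: g power_mult_distrib powr_powr powr_minus simp flip: powr_numeral)
  from diff[of s] obtain d where "(w has_real_derivative d) (at s)"
    unfolding w_def using real_differentiable_def by blast
  from DERIV_fun_powr[OF this ws, of "- 2 / 3"]
  have "(\<lambda>r. w r powr (- 2 / 3)) differentiable (at s)"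
    unfolding real_differentiable_def by blast
  then show "(\<lambda>r. inverse ((optimal_density M o1 f r)\<^sup>2)) differentiable (at s)"
    unfolding eq by (intro differentiable_mult differentiable_const)
qed

section \<open>Positivity of the profile mass\<close>

lemma insert_coord_measurable:
  fixes o1 :: "'n::finite"
  shows "insert_coord o1 s \<in> borel_measurable (other_coords o1)"
proof (subst borel_measurable_euclidean_space, rule ballI)
  fix b :: "real ^ 'n" assume "b \<in> Basis"
  then obtain i where b: "b = axis i 1"
    by (auto simp: Basis_vec_def)
  show "(\<lambda>x. insert_coord o1 s x \<bullet> b) \<in> borel_measurable (other_coords o1)"
    by (cases "i = o1") (auto simp: b inner_axis insert_coord_def other_coords_def)
qed

lemma moment_dominates:
  assumes "\<And>x. 0 \<le> f x"
  shows "s\<^sup>2 * f (insert_coord o1 s x) \<le> moment_integrand o1 f s x"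
proof -
  have "(insert_coord o1 s x $ o1)\<^sup>2 \<le> (\<Sum>k\<in>UNIV. (insert_coord o1 s x $ k)\<^sup>2)"
    by (rule member_le_sum) auto
  then show ?thesis
    unfolding moment_integrand_def using assms
    by (intro mult_right_mono) (simp_all add: insert_coord_def)
qed

text \<open>
  Off the hyperplane \<open>s = 0\<close>, the finite second moment dominates \<open>s\<^sup>2\<close> times the slice of the density.
  Restricting to \<open>s \<noteq> 0\<close> is harmless for \<open>profile_mass_pos\<close> below, since a single \<open>s\<close> has
  measure zero.
\<close>
lemma slice_integrable:
  assumes nonneg: "\<And>x. 0 \<le> f x" and cont: "continuous_on UNIV f"
    and moment: "integrable (other_coords o1) (moment_integrand o1 f s)" and "s \<noteq> 0"
  shows "integrable (other_coords o1) (\<lambda>x. f (insert_coord o1 s x))"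
proof (rule Bochner_Integration.integrable_bound)
  show "integrable (other_coords o1) (\<lambda>x. inverse (s\<^sup>2) * moment_integrand o1 f s x)"
    using moment by simp
  show "(\<lambda>x. f (insert_coord o1 s x)) \<in> borel_measurable (other_coords o1)"
    using measurable_compose[OF insert_coord_measurable borel_measurable_continuous_onI[OF cont]] .
  have "f (insert_coord o1 s x) \<le> inverse (s\<^sup>2) * moment_integrand o1 f s x" for x
    using moment_dominates[of f s o1 x, OF nonneg] \<open>s \<noteq> 0\<close> by (simp add: field_simps)
  then show "AE x in other_coords o1. norm (f (insert_coord o1 s x))
      \<le> norm (inverse (s\<^sup>2) * moment_integrand o1 f s x)"
    using nonneg by (intro AE_I2) (simp only: real_norm_def abs_of_nonneg order_trans[OF _ abs_ge_self])
qed

text \<open>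
  The cube has measure \<open>(2 e)\<^sup>m\<close>, where \<open>m\<close> is the number of other coordinates.  For \<open>m = 0\<close> the
  condition on \<open>x\<close> is vacuous and \<open>other_coords\<close> is a unit point mass.
\<close>
lemma open_cube_not_null:
  fixes y :: "'n::finite \<Rightarrow> real"
  assumes "0 < e" and "AE x in other_coords o1. \<not> (\<forall>k\<in>UNIV - {o1}. \<bar>x k - y k\<bar> < e)"
  shows False
proof -
  interpret product_sigma_finite "\<lambda>_ :: 'n. lborel :: real measure"
    by standard
  define Q where "Q = Pi\<^sub>E (UNIV - {o1}) (\<lambda>k. {y k - e<..<y k + e})"
  have "Q \<in> sets (other_coords o1)"
    unfolding Q_def other_coords_def by (intro sets_PiM_I_finite) auto
  moreover have "AE x in other_coords o1. x \<notin> Q"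
    using assms(2) by eventually_elim (fastforce simp: Q_def PiE_def Pi_def abs_less_iff)
  moreover have "{x \<in> space (other_coords o1). x \<in> Q} = Q"
    using sets.sets_into_space[OF \<open>Q \<in> sets (other_coords o1)\<close>] by blast
  ultimately have "emeasure (other_coords o1) Q = 0"
    using emeasure_eq_0_AE[of "\<lambda>x. x \<in> Q" "other_coords o1"] by simp
  moreover have "emeasure (other_coords o1) Q = (\<Prod>k\<in>UNIV - {o1}. ennreal (2 * e))"
    unfolding Q_def other_coords_def using \<open>0 < e\<close> by (subst emeasure_PiM) auto
  ultimately show False
    using \<open>0 < e\<close> by simp
qed

text \<open>
  A vanishing marginal would force the slice to vanish almost everywhere, contradicting its positivity
  on a cube.  The second moment is then positive because it is at least \<open>s\<^sup>2\<close> times the marginal.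
\<close>
lemma profile_pos:
  assumes nonneg: "\<And>x. 0 \<le> f x" and cont: "continuous_on UNIV f"
    and moment: "integrable (other_coords o1) (moment_integrand o1 f s)" and "s \<noteq> 0" "0 < e"
    and pos: "\<And>x. \<forall>k\<in>UNIV - {o1}. \<bar>x k - y k\<bar> < e \<Longrightarrow> 0 < f (insert_coord o1 s x)"
  shows "0 < profile o1 f s"
proof -
  note int = slice_integrable[OF nonneg cont moment \<open>s \<noteq> 0\<close>]
  have "marginal o1 f s \<noteq> 0"
  proof
    assume "marginal o1 f s = 0"
    then have "AE x in other_coords o1. f (insert_coord o1 s x) = 0"
      unfolding marginal_def using integral_nonneg_eq_0_iff_AE[OF int] nonneg by simp
    then have "AE x in other_coords o1. \<not> (\<forall>k\<in>UNIV - {o1}. \<bar>x k - y k\<bar> < e)"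
      by eventually_elim (use pos in force)
    with \<open>0 < e\<close> show False by (rule open_cube_not_null)
  qed
  with marginal_nonneg[of f, OF nonneg] have marg: "0 < marginal o1 f s"
    by (simp add: less_le)
  then have "0 < s\<^sup>2 * marginal o1 f s"
    using \<open>s \<noteq> 0\<close> by simp
  also have "\<dots> = (\<integral>x. s\<^sup>2 * f (insert_coord o1 s x) \<partial>other_coords o1)"
    by (simp add: marginal_def)
  also have "\<dots> \<le> (\<integral>x. moment_integrand o1 f s x \<partial>other_coords o1)"
    using int moment by (intro integral_mono moment_dominates nonneg) auto
  finally have "0 < sigma_rms o1 f s"
    using marg by (simp add: sigma_rms_def)
  with marg show ?thesis
    by (simp add: profile_def)
qed

lemma distributed_density_pos:
  assumes "prob_space P" "distributed P N X (\<lambda>x. ennreal (f x))"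
  shows "\<exists>x. 0 < f x"
proof (rule ccontr)
  interpret prob_space P by fact
  assume "\<nexists>x. 0 < f x"
  then have "ennreal (f x) = 0" for x
    by (simp add: ennreal_neg not_less)
  moreover have "X -` space N \<inter> space P = space P"
    using distributed_measurable[OF assms(2)] by (auto dest: measurable_space)
  ultimately have "emeasure P (space P) = 0"
    using distributed_emeasure[OF assms(2), of "space N"] by simp
  then show False by (simp add: emeasure_space_1)
qed

text \<open>
  A zero integral would make the profile vanish almost everywhere, but it is positive on the
  \<open>o1\<close>-projection of a cube around \<open>y\<close> on which \<open>f\<close> is positive, except possibly at \<open>s = 0\<close>.
\<close>
lemma profile_mass_pos:
  fixes f :: "real ^ 'n::finite \<Rightarrow> real"
  assumes nonneg: "\<And>x. 0 \<le> f x" and cont: "continuous_on UNIV f"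
    and moment: "\<And>s. integrable (other_coords o1) (moment_integrand o1 f s)"
    and int: "integrable lborel (profile o1 f)" and "0 < f y"
  shows "0 < profile_mass o1 f"
proof -
  have "isCont f y"
    using cont by (simp add: continuous_on_eq_continuous_at)
  then obtain d where d: "0 < d" "\<And>x. dist x y < d \<Longrightarrow> 0 < f x"
    using order_tendstoD(1)[of f "f y" "at y" 0] \<open>0 < f y\<close>
    unfolding isCont_def eventually_at by (metis UNIV_I)
  (* The Euclidean norm is at most CARD('n) times the sup norm. *)
  define e where "e = d / CARD('n)"
  have e: "0 < e" using d by (simp add: e_def)
  have cube: "0 < f x" if "\<And>k. \<bar>x $ k - y $ k\<bar> < e" for x
  proof (rule d(2))
    have "dist x y \<le> (\<Sum>k\<in>UNIV. \<bar>(x - y) $ k\<bar>)"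
      unfolding dist_norm by (rule norm_le_l1_cart)
    also have "\<dots> < (\<Sum>k\<in>(UNIV :: 'n set). e)"
      using that by (intro sum_strict_mono) auto
    finally show "dist x y < d" by (simp add: e_def)
  qed
  have pos: "0 < profile o1 f s" if "s \<noteq> 0" "\<bar>s - y $ o1\<bar> < e" for s
  proof (rule profile_pos[OF nonneg cont moment \<open>s \<noteq> 0\<close> e])
    fix x assume "\<forall>k\<in>UNIV - {o1}. \<bar>x k - y $ k\<bar> < e"
    with that show "0 < f (insert_coord o1 s x)"
      by (intro cube) (auto simp: insert_coord_def)
  qed
  have "profile_mass o1 f \<noteq> 0"
  proof
    assume "profile_mass o1 f = 0"
    then have "AE s in lborel. profile o1 f s = 0"
      unfolding profile_mass_def using integral_nonneg_eq_0_iff_AE[OF int] profile_nonneg by auto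
    moreover have "AE s in lborel. s \<noteq> (0::real)"
      by (rule AE_lborel_singleton)
    ultimately have "AE s in lborel. s \<notin> {y $ o1 - e<..<y $ o1 + e}"
      by eventually_elim (use pos in \<open>force simp: abs_less_iff\<close>)
    then have "emeasure lborel {y $ o1 - e<..<y $ o1 + e} = 0"
      using emeasure_eq_0_AE[of "\<lambda>s. s \<in> {y $ o1 - e<..<y $ o1 + e}" lborel]
      by (simp only: space_lborel space_borel Collect_mem_eq UNIV_I simp_thms)
    with e show False by simp
  qed
  moreover have "0 \<le> profile_mass o1 f"
    unfolding profile_mass_def by (intro Bochner_Integration.integral_nonneg profile_nonneg)
  ultimately show ?thesis by simp
qed

section \<open>The optimal density\<close>

theorem theorem3p1:
  fixes P :: "'w measure"
    and u :: "int \<Rightarrow> 'w \<Rightarrow> real"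
    and t :: int
    and e :: "'n::finite \<Rightarrow> nat"
    and o1 :: 'n
    and \<theta> :: "real ^ 'n"
    and \<theta>1 :: real
    and T :: "real ^ 'n ^ 'n"
    and f :: "real ^ 'n \<Rightarrow> real"
    and M :: nat
  assumes enum: "bij_betw e UNIV {..<CARD('n)}" "e o1 = 0"
    and P: "prob_space P"
    and u_indep: "prob_space.indep_vars P (\<lambda>_. borel) u UNIV"
    and T_orth: "orthogonal_matrix T"
    and T_\<theta>: "matrix_inv T *v \<theta> = axis o1 \<theta>1"
    and f_nonneg: "\<And>x. 0 \<le> f x"
    and f_density: "distributed P lborel (transformed_regressor e T u t) (\<lambda>x. ennreal (f x))"
    and f_cont: "continuous_on UNIV f"
    and f_expand: "second_order_expandable f"
    and moment_finite: "\<And>s. integrable (other_coords o1) (moment_integrand o1 f s)"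
    and moment_deriv: "\<And>s. (\<lambda>r. (sigma_rms o1 f r)\<^sup>2 * marginal o1 f r) differentiable (at s)"
    and D_finite: "integrable lborel (profile o1 f)"
    and M_pos: "0 < M"
  shows "is_arg_min (cost \<theta>1 o1 f) (step_density M) (optimal_density M o1 f)
    \<and> is_arg_min (cost \<theta>1 o1 f) (\<lambda>g. step_density M g \<and> regular_density g) (optimal_density M o1 f)
    \<and> (\<theta>1 \<noteq> 0 \<longrightarrow> (\<forall>g. is_arg_min (cost \<theta>1 o1 f) (step_density M) g
          \<longrightarrow> (AE s in lborel. g s = optimal_density M o1 f s)))
    \<and> cost \<theta>1 o1 f (optimal_density M o1 f)
        = ennreal (1 / 12 * \<theta>1\<^sup>2 * (profile_mass o1 f) ^ 3 * inverse ((real M)\<^sup>2))"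
proof -
  define c where "c = 1 / 12 * \<theta>1\<^sup>2"
  define D where "D = profile_mass o1 f"
  let ?g = "optimal_density M o1 f"
  have c: "0 \<le> c" by (simp add: c_def)
  have M: "0 < real M" using M_pos by simp
  from distributed_density_pos[OF P f_density] obtain y where "0 < f y" ..
  then have D: "0 < D"
    unfolding D_def by (intro profile_mass_pos f_nonneg f_cont moment_finite D_finite)
  have p: "has_bochner_integral lborel (profile o1 f) D"
    using D_finite by (simp add: has_bochner_integral_iff D_def profile_mass_def)
  have g_eq: "?g = (\<lambda>s. real M / D * profile o1 f s)"
    by (simp add: fun_eq_iff optimal_density_def D_def divide_inverse mult.commute)
  have cost: "cost \<theta>1 o1 f g = allocation_cost lborel c (profile o1 f) g" for g
    unfolding c_def by (rule cost_eq_allocation_cost[OF f_nonneg])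
  have optimum: "cost \<theta>1 o1 f ?g = ennreal (c * D ^ 3 / (real M)\<^sup>2)"
    unfolding cost g_eq by (rule allocation_cost_optimal[OF p profile_nonneg c D M])
  have admissible: "step_density M ?g"
  proof -
    have "has_bochner_integral lborel ?g (real M / D * D)"
      unfolding g_eq by (intro has_bochner_integral_mult_right p)
    moreover have "0 \<le> ?g s" for s
      using D by (simp add: g_eq profile_nonneg)
    ultimately show ?thesis
      using D by (simp add: step_density_def)
  qed
  have lower: "cost \<theta>1 o1 f ?g \<le> cost \<theta>1 o1 f g" if "step_density M g" for g
    unfolding optimum unfolding cost using that
    by (intro allocation_lower_bound[OF p profile_nonneg _ _ c D M]) (auto simp: step_density_def)
  have unique: "AE s in lborel. g s = ?g s"
    if "\<theta>1 \<noteq> 0" and g: "is_arg_min (cost \<theta>1 o1 f) (step_density M) g" for g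
  proof -
    have "step_density M g" and "cost \<theta>1 o1 f g \<le> cost \<theta>1 o1 f ?g"
      using g admissible by (auto simp: is_arg_min_def not_less)
    then have g: "has_bochner_integral lborel g (real M)" "\<And>s. 0 \<le> g s"
      and le: "allocation_cost lborel c (profile o1 f) g \<le> ennreal (c * D ^ 3 / (real M)\<^sup>2)"
      by (simp_all only: step_density_def cost optimum[unfolded cost])
    have "0 < c" using \<open>\<theta>1 \<noteq> 0\<close> by (simp add: c_def)
    from allocation_unique[OF p profile_nonneg g this D M le] show ?thesis
      by (simp add: g_eq)
  qed
  have "regular_density ?g"
    by (rule regular_optimal_density[OF f_nonneg moment_deriv])
  with admissible lower have "is_arg_min (cost \<theta>1 o1 f) (step_density M) ?g"
    and "is_arg_min (cost \<theta>1 o1 f) (\<lambda>g. step_density M g \<and> regular_density g) ?g"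
    unfolding is_arg_min_linorder by blast+
  moreover have "cost \<theta>1 o1 f ?g
      = ennreal (1 / 12 * \<theta>1\<^sup>2 * (profile_mass o1 f) ^ 3 * inverse ((real M)\<^sup>2))"
    using optimum by (simp only: c_def D_def divide_inverse)
  ultimately show ?thesis
    using unique by blast
qed

end
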